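(* Let $F:\ \mathcal{C}\to\mathcal{D}$ be a separable functor and let $\mathcal{T}$ be a full subcategory of $\mathcal{C}$. Let $C_1\in\mathcal{T}$ and $C\in\mathcal{C}$. (i) Let $f:\ C_1\to C$ be a morphism in $\mathcal{C}$. If $F(f):\ F(C_1)\to F(C)$ is a right $F(\mathcal{T})$-approximation of $F(C)$, then $f:\ C_1\to C$ is a right $\mathcal{T}$-approximation of $C$. (ii) Let $f:\ C\to C_1$ be a morphism in $\mathcal{C}$. If $F(f):\ F(C)\to F(C_1)$ is a left $F(\mathcal{T})$-approximation of $F(C)$, then $f:\ C\to C_1$ is a left $\mathcal{T}$-approximation of $C$.
   Context: A covariant functor $F:\ \mathcal{C}\to\mathcal{D}$ is separable if the natural transformation $\mathcal{F}:\ \mathrm{Hom}_{\mathcal{C}}(\bullet,\bullet)\to\mathrm{Hom}_{\mathcal{D}}(F(\bullet),F(\bullet))$, $\mathcal{F}_{C,C'}(f)=F(f)$, has a left inverse natural transformation, i.e. there is a natural transformation (of functors $\mathcal{C}^{\mathrm{op}}\times\mathcal{C}\to\mathrm{Sets}$) $\mathcal{P}:\ \mathrm{Hom}_{\mathcal{D}}(F(\bullet),F(\bullet))\to\mathrm{Hom}_{\mathcal{C}}(\bullet,\bullet)$ such that $\mathcal{P}\circ\mathcal{F}$ is the identity. For a full subcategory $\mathcal{E}$ of a category $\mathcal{D}$ and $X\in\mathcal{D}$, a right $\mathcal{E}$-approximation of $X$ is a morphism $f:\ X_1\to X$ with $X_1\in\mathcal{E}$ such that every morphism $E\to X$ with $E\in\mathcal{E}$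 factors through $f$; dually, a left $\mathcal{E}$-approximation of $X$ is a morphism $f:\ X\to X_1$ with $X_1\in\mathcal{E}$ such that every morphism $X\to E$ with $E\in\mathcal{E}$ factors through $f$. $F(\mathcal{T})$ is the full subcategory of $\mathcal{D}$ consisting of objects isomorphic to some $F(T)$ with $T\in\mathcal{T}$. *)

theory Defs
  imports Main
begin

record ('o, 'm) cat =
  Obj :: "'o set"
  Arr :: "'m set"
  Dom :: "'m \<Rightarrow> 'o"
  Cod :: "'m \<Rightarrow> 'o"
  Ident :: "'o \<Rightarrow> 'm"
  Comp :: "'m \<Rightarrow> 'm \<Rightarrow> 'm"  (infixl "\<cdot>\<index>" 70)

definition hom :: "('o, 'm, 'z) cat_scheme \<Rightarrow> 'o \<Rightarrow> 'o \<Rightarrow> 'm set" where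
  "hom C X Y = {f \<in> Arr C. Dom C f = X \<and> Cod C f = Y}"

text \<open>Composition is written in the usual order: \<open>g \<cdot> f\<close> is ``first \<open>f\<close>, then \<open>g\<close>''.
  It is constrained only on composable pairs of arrows.\<close>

locale category =
  fixes C :: "('o, 'm, 'z) cat_scheme" (structure)
  assumes Dom_Obj: "f \<in> Arr C \<Longrightarrow> Dom C f \<in> Obj C"
    and Cod_Obj: "f \<in> Arr C \<Longrightarrow> Cod C f \<in> Obj C"
    and Ident_hom: "X \<in> Obj C \<Longrightarrow> Ident C X \<in> hom C X X"
    and Comp_hom: "\<lbrakk>f \<in> hom C X Y; g \<in> hom C Y Z\<rbrakk> \<Longrightarrow> g \<cdot> f \<in> hom C X Z"
    and Ident_left: "f \<in> hom C X Y \<Longrightarrow> Ident C Y \<cdot> f = f"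
    and Ident_right: "f \<in> hom C X Y \<Longrightarrow> f \<cdot> Ident C X = f"
    and Comp_assoc: "\<lbrakk>f \<in> hom C W X; g \<in> hom C X Y; h \<in> hom C Y Z\<rbrakk>
      \<Longrightarrow> h \<cdot> g \<cdot> f = h \<cdot> (g \<cdot> f)"

definition isomorphic :: "('o, 'm, 'z) cat_scheme \<Rightarrow> 'o \<Rightarrow> 'o \<Rightarrow> bool" where
  "isomorphic C X Y \<longleftrightarrow> (\<exists>f \<in> hom C X Y. \<exists>g \<in> hom C Y X.
     g \<cdot>\<^bsub>C\<^esub> f = Ident C X \<and> f \<cdot>\<^bsub>C\<^esub> g = Ident C Y)"

definition op_cat :: "('o, 'm, 'z) cat_scheme \<Rightarrow> ('o, 'm) cat" where
  "op_cat C = \<lparr>Obj = Obj C, Arr = Arr C, Dom = Cod C, Cod = Dom C, Ident = Ident C,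
     Comp = (\<lambda>g f. f \<cdot>\<^bsub>C\<^esub> g)\<rparr>"

definition prod_cat ::
  "('o, 'm, 'z) cat_scheme \<Rightarrow> ('p, 'n, 'w) cat_scheme \<Rightarrow> ('o \<times> 'p, 'm \<times> 'n) cat" where
  "prod_cat C D = \<lparr>Obj = Obj C \<times> Obj D, Arr = Arr C \<times> Arr D,
     Dom = map_prod (Dom C) (Dom D), Cod = map_prod (Cod C) (Cod D),
     Ident = map_prod (Ident C) (Ident D),
     Comp = (\<lambda>(g, g') (f, f'). (g \<cdot>\<^bsub>C\<^esub> f, g' \<cdot>\<^bsub>D\<^esub> f'))\<rparr>"

record ('o, 'm, 'p, 'n) ftor =
  on_obj :: "'o \<Rightarrow> 'p"
  on_arr :: "'m \<Rightarrow> 'n"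

locale cov_functor = dom: category C + cod: category D
  for C :: "('o, 'm, 'z) cat_scheme" and D :: "('p, 'n, 'w) cat_scheme"
    and F :: "('o, 'm, 'p, 'n) ftor" +
  assumes on_obj: "X \<in> Obj C \<Longrightarrow> on_obj F X \<in> Obj D"
    and on_arr: "f \<in> hom C X Y \<Longrightarrow> on_arr F f \<in> hom D (on_obj F X) (on_obj F Y)"
    and on_Ident: "X \<in> Obj C \<Longrightarrow> on_arr F (Ident C X) = Ident D (on_obj F X)"
    and on_Comp: "\<lbrakk>f \<in> hom C X Y; g \<in> hom C Y Z\<rbrakk>
      \<Longrightarrow> on_arr F (g \<cdot>\<^bsub>C\<^esub> f) = on_arr F g \<cdot>\<^bsub>D\<^esub> on_arr F f"

text \<open>A functor from \<open>C\<close> to sets whose values are sets of elements of a type \<open>'x\<close>. The map of sets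
  \<open>on_arr G f\<close> matters only on \<open>on_obj G (Dom C f)\<close>, so all equations between such maps
  are restricted to that domain.\<close>

locale set_functor = category C
  for C :: "('o, 'm, 'z) cat_scheme" and G :: "('o, 'm, 'x set, 'x \<Rightarrow> 'x) ftor" +
  assumes map_in: "\<lbrakk>f \<in> hom C X Y; x \<in> on_obj G X\<rbrakk> \<Longrightarrow> on_arr G f x \<in> on_obj G Y"
    and map_Ident: "\<lbrakk>X \<in> Obj C; x \<in> on_obj G X\<rbrakk> \<Longrightarrow> on_arr G (Ident C X) x = x"
    and map_Comp: "\<lbrakk>f \<in> hom C X Y; g \<in> hom C Y Z; x \<in> on_obj G X\<rbrakk>
      \<Longrightarrow> on_arr G (g \<cdot>\<^bsub>C\<^esub> f) x = on_arr G g (on_arr G f x)"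

locale nat_trans = source: set_functor C G + target: set_functor C H
  for C :: "('o, 'm, 'z) cat_scheme"
    and G :: "('o, 'm, 'x set, 'x \<Rightarrow> 'x) ftor" and H :: "('o, 'm, 'y set, 'y \<Rightarrow> 'y) ftor"
    and \<eta> :: "'o \<Rightarrow> 'x \<Rightarrow> 'y" +
  assumes component: "\<lbrakk>X \<in> Obj C; x \<in> on_obj G X\<rbrakk> \<Longrightarrow> \<eta> X x \<in> on_obj H X"
    and naturality: "\<lbrakk>f \<in> hom C X Y; x \<in> on_obj G X\<rbrakk>
      \<Longrightarrow> \<eta> Y (on_arr G f x) = on_arr H f (\<eta> X x)"

text \<open>\<open>Hom\<^sub>C(\<bullet>, \<bullet>)\<close> on \<open>C\<^sup>o\<^sup>p \<times> C\<close>: an arrow \<open>(X, Y) \<rightarrow> (X', Y')\<close> is a pair \<open>(a, b)\<close> with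
  \<open>a : X' \<rightarrow> X\<close> and \<open>b : Y \<rightarrow> Y'\<close> in \<open>C\<close>.\<close>

definition hom_bifunctor ::
  "('o, 'm, 'z) cat_scheme \<Rightarrow> ('o \<times> 'o, 'm \<times> 'm, 'm set, 'm \<Rightarrow> 'm) ftor" where
  "hom_bifunctor C = \<lparr>on_obj = (\<lambda>(X, Y). hom C X Y),
     on_arr = (\<lambda>(a, b) h. b \<cdot>\<^bsub>C\<^esub> h \<cdot>\<^bsub>C\<^esub> a)\<rparr>"

text \<open>\<open>Hom\<^sub>D(F(\<bullet>), F(\<bullet>))\<close> on \<open>C\<^sup>o\<^sup>p \<times> C\<close>.\<close>

definition hom_bifunctor_along ::
  "('p, 'n, 'w) cat_scheme \<Rightarrow> ('o, 'm, 'p, 'n) ftor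
     \<Rightarrow> ('o \<times> 'o, 'm \<times> 'm, 'n set, 'n \<Rightarrow> 'n) ftor" where
  "hom_bifunctor_along D F =
     \<lparr>on_obj = (\<lambda>p. on_obj (hom_bifunctor D) (map_prod (on_obj F) (on_obj F) p)),
      on_arr = (\<lambda>u. on_arr (hom_bifunctor D) (map_prod (on_arr F) (on_arr F) u))\<rparr>"

definition functor_trans :: "('o, 'm, 'p, 'n) ftor \<Rightarrow> 'o \<times> 'o \<Rightarrow> 'm \<Rightarrow> 'n" where
  "functor_trans F = (\<lambda>(X, Y) f. on_arr F f)"

definition separable ::
  "('o, 'm, 'z) cat_scheme \<Rightarrow> ('p, 'n, 'w) cat_scheme \<Rightarrow> ('o, 'm, 'p, 'n) ftor \<Rightarrow> bool" where
  "separable C D F \<longleftrightarrow> cov_functor C D F \<and>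
     (\<exists>P. nat_trans (prod_cat (op_cat C) C) (hom_bifunctor_along D F) (hom_bifunctor C) P \<and>
        (\<forall>p \<in> Obj (prod_cat (op_cat C) C). \<forall>f \<in> on_obj (hom_bifunctor C) p.
           P p (functor_trans F p f) = f))"

text \<open>A full subcategory is given by its set of objects; its morphisms are all morphisms of the
  ambient category between them.\<close>

definition image_objs ::
  "('p, 'n, 'w) cat_scheme \<Rightarrow> ('o, 'm, 'p, 'n) ftor \<Rightarrow> 'o set \<Rightarrow> 'p set" where
  "image_objs D F \<T> = {Y \<in> Obj D. \<exists>T \<in> \<T>. isomorphic D Y (on_obj F T)}"

definition right_approximation ::
  "('o, 'm, 'z) cat_scheme \<Rightarrow> 'o set \<Rightarrow> 'o \<Rightarrow> 'o \<Rightarrow> 'm \<Rightarrow> bool" where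
  "right_approximation D \<E> X\<^sub>1 X f \<longleftrightarrow> X\<^sub>1 \<in> \<E> \<and> f \<in> hom D X\<^sub>1 X \<and>
     (\<forall>E \<in> \<E>. \<forall>g \<in> hom D E X. \<exists>h \<in> hom D E X\<^sub>1. g = f \<cdot>\<^bsub>D\<^esub> h)"

definition left_approximation ::
  "('o, 'm, 'z) cat_scheme \<Rightarrow> 'o set \<Rightarrow> 'o \<Rightarrow> 'o \<Rightarrow> 'm \<Rightarrow> bool" where
  "left_approximation D \<E> X X\<^sub>1 f \<longleftrightarrow> X\<^sub>1 \<in> \<E> \<and> f \<in> hom D X X\<^sub>1 \<and>
     (\<forall>E \<in> \<E>. \<forall>g \<in> hom D X E. \<exists>h \<in> hom D X\<^sub>1 E. g = h \<cdot>\<^bsub>D\<^esub> f)"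

end

theory Submission
  imports Defs
begin

text \<open>Let \<open>P\<close> be the natural left inverse of \<open>f \<mapsto> F f\<close> on hom-sets. If \<open>F g = F f \<cdot> h\<close>, then
  naturality turns \<open>h\<close> into a factorization upstairs: \<open>g = P (F f \<cdot> h) = f \<cdot> P h\<close>.
  The other side is dual.\<close>

lemma (in category) Obj_if_hom:
  assumes "f \<in> hom C X Y"
  shows "X \<in> Obj C" and "Y \<in> Obj C"
  using assms Dom_Obj Cod_Obj by (auto simp: hom_def)

lemma (in category) isomorphic_refl: "X \<in> Obj C \<Longrightarrow> isomorphic C X X"
  unfolding isomorphic_def using Ident_hom Ident_left by blast

text \<open>The identity of \<open>on_obj F T\<close> witnesses the isomorphism. Hence an
  approximation property in \<open>D\<close> can be tested on the objects \<open>on_obj F T\<close>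
  themselves.\<close>

lemma (in cov_functor) on_obj_in_image_objs:
  assumes "T \<in> \<T>" and "T \<in> Obj C"
  shows "on_obj F T \<in> image_objs D F \<T>"
  using assms on_obj cod.isomorphic_refl by (auto simp: image_objs_def)

text \<open>The arrow \<open>h\<close> need not be the image of an arrow of \<open>C\<close>; its
  value under the natural left inverse stands in for a preimage. No subcategory occurs here, so the
  free end (\<open>X\<close> on the right-hand side, \<open>Z\<close> in the dual) can later be any
  object of \<open>\<T>\<close>.\<close>

lemma
  assumes "separable C D F"
  shows separable_reflects_right_factorization: "\<lbrakk>f \<in> hom C Y Z; g \<in> hom C X Z; h \<in> hom D (on_obj F X) (on_obj F Y);
      on_arr F g = on_arr F f \<cdot>\<^bsub>D\<^esub> h\<rbrakk> \<Longrightarrow> \<exists>h' \<in> hom C X Y. g = f \<cdot>\<^bsub>C\<^esub> h'"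
    and separable_reflects_left_factorization: "\<lbrakk>f \<in> hom C X Y; g \<in> hom C X Z; h \<in> hom D (on_obj F Y) (on_obj F Z);
      on_arr F g = h \<cdot>\<^bsub>D\<^esub> on_arr F f\<rbrakk> \<Longrightarrow> \<exists>h' \<in> hom C Y Z. g = h' \<cdot>\<^bsub>C\<^esub> f"
proof -
  interpret cov_functor C D F
    using assms by (simp add: separable_def)
  obtain P where "nat_trans (prod_cat (op_cat C) C) (hom_bifunctor_along D F) (hom_bifunctor C) P"
    and inv: "\<forall>p \<in> Obj (prod_cat (op_cat C) C). \<forall>f \<in> on_obj (hom_bifunctor C) p.
      P p (functor_trans F p f) = f"
    using assms by (auto simp: separable_def)
  then interpret P: nat_trans "prod_cat (op_cat C) C" "hom_bifunctor_along D F" "hom_bifunctor C" P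
    by simp
  note simps = prod_cat_def op_cat_def hom_bifunctor_def hom_bifunctor_along_def functor_trans_def
  have P_hom: "P (X, Y) k \<in> hom C X Y"
    if "X \<in> Obj C" "Y \<in> Obj C" "k \<in> hom D (on_obj F X) (on_obj F Y)" for X Y k
    using P.component[of "(X, Y)" k] that by (simp add: simps)
  have P_inv: "P (X, Y) (on_arr F f) = f" if "f \<in> hom C X Y" for X Y f
    using inv[rule_format, of "(X, Y)" f] that dom.Obj_if_hom[OF that] by (simp add: simps)
  \<comment> \<open>The naturality square of \<open>P\<close> at the arrow \<open>(a, b)\<close>. It
    runs from \<open>(X, Y)\<close> to \<open>(X', Y')\<close> because the first component is
    reversed: in \<open>C\<close>, \<open>a\<close> goes from \<open>X'\<close> to
    \<open>X\<close>.\<close>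
  have P_nat: "P (X', Y') (on_arr F b \<cdot>\<^bsub>D\<^esub> k \<cdot>\<^bsub>D\<^esub> on_arr F a) = b \<cdot>\<^bsub>C\<^esub> P (X, Y) k \<cdot>\<^bsub>C\<^esub> a"
    if "a \<in> hom C X' X" "b \<in> hom C Y Y'" "k \<in> hom D (on_obj F X) (on_obj F Y)"
    for X X' Y Y' a b k
  proof -
    have "(a, b) \<in> hom (prod_cat (op_cat C) C) (X, Y) (X', Y')"
      using that by (simp add: hom_def prod_cat_def op_cat_def)
    from P.naturality[OF this, of k] that(3) show ?thesis
      by (simp add: simps)
  qed
  show "\<exists>h' \<in> hom C X Y. g = f \<cdot>\<^bsub>C\<^esub> h'"
    if f: "f \<in> hom C Y Z" and g: "g \<in> hom C X Z" and h: "h \<in> hom D (on_obj F X) (on_obj F Y)"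
      and eq: "on_arr F g = on_arr F f \<cdot>\<^bsub>D\<^esub> h"
  proof
    have X: "X \<in> Obj C" and Y: "Y \<in> Obj C"
      using f g dom.Obj_if_hom by blast+
    show Ph: "P (X, Y) h \<in> hom C X Y"
      using X Y h by (rule P_hom)
    \<comment> \<open>An identity is appended to reach the three-factor shape of
      \<open>P_nat\<close>. Composition associates to the left, so the first two factors form
      \<open>on_arr F g\<close>, and the identity drops off from there.\<close>
    have "g = P (X, Z) (on_arr F f \<cdot>\<^bsub>D\<^esub> h \<cdot>\<^bsub>D\<^esub> on_arr F (Ident C X))"
      using P_inv[OF g] cod.Ident_right[OF on_arr[OF g]] on_Ident[OF X] eq by simp
    \<comment> \<open>Naturality with \<open>a = Ident C X\<close> and \<open>b = f\<close> pulls
      \<open>f\<close> out of \<open>P\<close>; the identity left over in \<open>C\<close> is then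
      cancelled.\<close>
    also have "\<dots> = f \<cdot>\<^bsub>C\<^esub> P (X, Y) h"
      using P_nat[OF dom.Ident_hom[OF X] f h] dom.Ident_right[OF dom.Comp_hom[OF Ph f]] by simp
    finally show "g = f \<cdot>\<^bsub>C\<^esub> P (X, Y) h" .
  qed
  show "\<exists>h' \<in> hom C Y Z. g = h' \<cdot>\<^bsub>C\<^esub> f"
    if f: "f \<in> hom C X Y" and g: "g \<in> hom C X Z" and h: "h \<in> hom D (on_obj F Y) (on_obj F Z)"
      and eq: "on_arr F g = h \<cdot>\<^bsub>D\<^esub> on_arr F f"
  proof
    have Y: "Y \<in> Obj C" and Z: "Z \<in> Obj C"
      using f g dom.Obj_if_hom by blast+
    show Ph: "P (Y, Z) h \<in> hom C Y Z"
      using Y Z h by (rule P_hom)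
    \<comment> \<open>Dually, the identity is put in front, at \<open>Z\<close>, where
      \<open>h\<close> absorbs it directly.\<close>
    have "g = P (X, Z) (on_arr F (Ident C Z) \<cdot>\<^bsub>D\<^esub> h \<cdot>\<^bsub>D\<^esub> on_arr F f)"
      using P_inv[OF g] cod.Ident_left[OF h] on_Ident[OF Z] eq by simp
    also have "\<dots> = P (Y, Z) h \<cdot>\<^bsub>C\<^esub> f"
      using P_nat[OF f dom.Ident_hom[OF Z] h] dom.Ident_left[OF Ph] by simp
    finally show "g = P (Y, Z) h \<cdot>\<^bsub>C\<^esub> f" .
  qed
qed

theorem proposition5p1:
  fixes C :: "('o, 'm) cat" and D :: "('p, 'n) cat" and F :: "('o, 'm, 'p, 'n) ftor"
    and \<T> :: "'o set" and C\<^sub>1 C\<^sub>0 :: 'o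
  assumes "category C" and "category D" and "cov_functor C D F" and "separable C D F"
    and "\<T> \<subseteq> Obj C" and "C\<^sub>1 \<in> \<T>" and "C\<^sub>0 \<in> Obj C"
  shows "(\<forall>f \<in> hom C C\<^sub>1 C\<^sub>0.
            right_approximation D (image_objs D F \<T>) (on_obj F C\<^sub>1) (on_obj F C\<^sub>0) (on_arr F f)
              \<longrightarrow> right_approximation C \<T> C\<^sub>1 C\<^sub>0 f)
       \<and> (\<forall>f \<in> hom C C\<^sub>0 C\<^sub>1.
            left_approximation D (image_objs D F \<T>) (on_obj F C\<^sub>0) (on_obj F C\<^sub>1) (on_arr F f)
              \<longrightarrow> left_approximation C \<T> C\<^sub>0 C\<^sub>1 f)"
proof (intro conjI ballI impI)
  interpret cov_functor C D F
    by (fact assms(3))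
  have image: "on_obj F T \<in> image_objs D F \<T>" if "T \<in> \<T>" for T
    using on_obj_in_image_objs that assms(5) by blast
  show "right_approximation C \<T> C\<^sub>1 C\<^sub>0 f"
    if f: "f \<in> hom C C\<^sub>1 C\<^sub>0"
      and approx: "right_approximation D (image_objs D F \<T>) (on_obj F C\<^sub>1) (on_obj F C\<^sub>0) (on_arr F f)"
    for f
    unfolding right_approximation_def
  proof (intro conjI ballI)
    fix T g assume "T \<in> \<T>" and g: "g \<in> hom C T C\<^sub>0"
    \<comment> \<open>The approximation in \<open>D\<close> is tested on \<open>on_arr F g\<close>,
      whose source \<open>on_obj F T\<close> lies in the image of \<open>\<T>\<close>.\<close>
    then obtain h where "h \<in> hom D (on_obj F T) (on_obj F C\<^sub>1)" "on_arr F g = on_arr F f \<cdot>\<^bsub>D\<^esub> h"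
      using approx image on_arr unfolding right_approximation_def by blast
    with assms(4) f g show "\<exists>h \<in> hom C T C\<^sub>1. g = f \<cdot>\<^bsub>C\<^esub> h"
      by (rule separable_reflects_right_factorization)
  qed (use assms(6) f in auto)
  show "left_approximation C \<T> C\<^sub>0 C\<^sub>1 f"
    if f: "f \<in> hom C C\<^sub>0 C\<^sub>1"
      and approx: "left_approximation D (image_objs D F \<T>) (on_obj F C\<^sub>0) (on_obj F C\<^sub>1) (on_arr F f)"
    for f
    unfolding left_approximation_def
  proof (intro conjI ballI)
    fix T g assume "T \<in> \<T>" and g: "g \<in> hom C C\<^sub>0 T"
    \<comment> \<open>Now it is the target of \<open>on_arr F g\<close> that lies in the image of
      \<open>\<T>\<close>.\<close>
    then obtain h where "h \<in> hom D (on_obj F C\<^sub>1) (on_obj F T)" "on_arr F g = h \<cdot>\<^bsub>D\<^esub> on_arr F f"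
      using approx image on_arr unfolding left_approximation_def by blast
    with assms(4) f g show "\<exists>h \<in> hom C C\<^sub>1 T. g = h \<cdot>\<^bsub>C\<^esub> f"
      by (rule separable_reflects_left_factorization)
  qed (use assms(6) f in auto)
qed

end
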